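(* Let $d\ge 0$ be an integer, let $n=3^d$, and let $D_n=\langle a,b\mid a^n=b^2=(ab)^2=1\rangle=\{1,a,\dots,a^{n-1},b,ab,\dots,a^{n-1}b\}$ be the dihedral group of order $2n$. Let $C=\{a^{3^i}b\mid 0\le i\le d\}\subseteq D_n$ and $G=\mathrm{Cay}(D_n,C)$. Let \[M=\{a^{i}\mid 1\le i\le n-1,\ [i]_3=1\}\cup\{a^{i}b\mid 1\le i\le n-1,\ [i]_3=2\}\cup\{1,b\}.\] Then $|M|=n+1$ and the subgraph of $G$ induced by $M$ is a matching. As a consequence, $\sigma(G)=1$.
   Context: For a positive integer $m$, $[m]_3\in\{1,2\}$ denotes the right-most nonzero digit of $m$ in base $3$. For a group $\Gamma$ and $C\subseteq\Gamma$, $\mathrm{Cay}(\Gamma,C)$ is the simple undirected graph on $\Gamma$ in which $\{x,y\}$ is an edge iff $x^{-1}y\in C$ (or $y^{-1}x\in C$). For a graph $G=(V,E)$, $\alpha(G)$ is the independence number, $\Delta(H)$ the maximum degree, $G[K]$ the subgraph induced by $K\subseteq V$, and the sensitivity $\sigma(G)$ is the minimum of $\Delta(G[K])$ over all $K\subseteq V$ with $|K|>\alpha(G)$. *)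

theory Defs
  imports "HOL-Algebra.Group" "HOL-Library.Ramsey"
begin

text \<open>
  A word is a list of letters; the letter \<open>(x, True)\<close> stands for the generator \<open>x\<close> and
  \<open>(x, False)\<close> for its formal inverse. \<open>word_eq R\<close> is the congruence on words obtained from
  free cancellation and from deleting (or inserting) the relators in \<open>R\<close>, so that the quotient
  is the free group on the type \<open>'g\<close> modulo the normal closure of \<open>R\<close>.
\<close>

type_synonym 'g word = "('g \<times> bool) list"

inductive word_eq :: "'g word set \<Rightarrow> 'g word \<Rightarrow> 'g word \<Rightarrow> bool" for R where
  refl: "word_eq R u u"
| sym: "word_eq R u v \<Longrightarrow> word_eq R v u"
| trans: "word_eq R u v \<Longrightarrow> word_eq R v w \<Longrightarrow> word_eq R u w"
| cancel: "word_eq R (u @ [(x, e), (x, \<not> e)] @ v) (u @ v)"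
| relator: "r \<in> R \<Longrightarrow> word_eq R (u @ r @ v) (u @ v)"

definition word_class :: "'g word set \<Rightarrow> 'g word \<Rightarrow> 'g word set" where
  "word_class R u = {v. word_eq R u v}"

definition presented_group :: "'g word set \<Rightarrow> 'g word set monoid" where
  "presented_group R =
     \<lparr>carrier = range (word_class R),
      mult = (\<lambda>X Y. \<Union>u\<in>X. \<Union>v\<in>Y. word_class R (u @ v)),
      one = word_class R []\<rparr>"

lemma word_eq_append1: "word_eq R u u' \<Longrightarrow> word_eq R (u @ v) (u' @ v)"
proof (induction rule: word_eq.induct)
  case (cancel u x e w)
  show ?case using word_eq.cancel[of R u x e "w @ v"] by simp
next
  case (relator r u w)
  then show ?case using word_eq.relator[of r R u "w @ v"] by simp
qed (rule word_eq.refl, erule word_eq.sym, erule (1) word_eq.trans)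

lemma word_eq_append2: "word_eq R u u' \<Longrightarrow> word_eq R (v @ u) (v @ u')"
proof (induction rule: word_eq.induct)
  case (cancel u x e w)
  show ?case using word_eq.cancel[of R "v @ u" x e w] by simp
next
  case (relator r u w)
  then show ?case using word_eq.relator[of r R "v @ u" w] by simp
qed (rule word_eq.refl, erule word_eq.sym, erule (1) word_eq.trans)

lemma word_class_eq_iff: "word_class R u = word_class R v \<longleftrightarrow> word_eq R u v"
  proof
  assume "word_class R u = word_class R v"
  then have "v \<in> word_class R u" by (simp add: word_class_def word_eq.refl)
  then show "word_eq R u v" by (simp add: word_class_def)
next
  assume "word_eq R u v"
  then have "word_eq R u w = word_eq R v w" for w
    by (metis word_eq.sym word_eq.trans)
  then show "word_class R u = word_class R v" by (simp add: word_class_def)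
qed

lemma mult_word_class:
  "word_class R u \<otimes>\<^bsub>presented_group R\<^esub> word_class R v = word_class R (u @ v)"
proof -
  have "word_class R (u' @ v') = word_class R (u @ v)"
    if "u' \<in> word_class R u" "v' \<in> word_class R v" for u' v'
    unfolding word_class_eq_iff using that[unfolded word_class_def mem_Collect_eq]
    by (rule word_eq.sym[OF word_eq.trans[OF word_eq_append1 word_eq_append2]])
  then have "(\<Union>u'\<in>word_class R u. \<Union>v'\<in>word_class R v. word_class R (u' @ v'))
      = (\<Union>u'\<in>word_class R u. \<Union>v'\<in>word_class R v. word_class R (u @ v))"
    by (intro SUP_cong HOL.refl)
  moreover have "u \<in> word_class R u" and "v \<in> word_class R v"
    by (auto simp: word_class_def intro: word_eq.refl)
  then have "(\<Union>u'\<in>word_class R u. \<Union>v'\<in>word_class R v. word_class R (u @ v)) = word_class R (u @ v)"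
    by blast
  ultimately show ?thesis
    by (simp add: presented_group_def)
qed

lemma group_presented_group: "group (presented_group R)"
proof (rule groupI)
  fix X assume "X \<in> carrier (presented_group R)"
  then obtain u where X: "X = word_class R u" by (auto simp: presented_group_def)
  have "word_eq R (map (\<lambda>(x, e). (x, \<not> e)) (rev u) @ u) []"
  proof (induction u)
    case (Cons l u)
    obtain x e where "l = (x, e)" by (cases l)
    then show ?case
      using word_eq.trans[OF word_eq.cancel[of R "map (\<lambda>(x, e). (x, \<not> e)) (rev u)" x "\<not> e" u] Cons]
      by simp
  qed (simp add: word_eq.refl)
  then have "word_class R (map (\<lambda>(x, e). (x, \<not> e)) (rev u)) \<otimes>\<^bsub>presented_group R\<^esub> X
      = \<one>\<^bsub>presented_group R\<^esub>"
    unfolding X mult_word_class by (simp add: presented_group_def word_class_eq_iff)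
  then show "\<exists>Y\<in>carrier (presented_group R). Y \<otimes>\<^bsub>presented_group R\<^esub> X = \<one>\<^bsub>presented_group R\<^esub>"
    by (rule bexI) (simp add: presented_group_def)
next
  show "\<one>\<^bsub>presented_group R\<^esub> \<in> carrier (presented_group R)"
    by (simp add: presented_group_def)
next
  fix X assume "X \<in> carrier (presented_group R)"
  then obtain u where "X = word_class R u" by (auto simp: presented_group_def)
  moreover have "\<one>\<^bsub>presented_group R\<^esub> = word_class R []" by (simp add: presented_group_def)
  ultimately show "\<one>\<^bsub>presented_group R\<^esub> \<otimes>\<^bsub>presented_group R\<^esub> X = X"
    by (simp add: mult_word_class)
next
  have C: "carrier (presented_group R) = range (word_class R)" by (simp add: presented_group_def)
  fix X Y assume "X \<in> carrier (presented_group R)" "Y \<in> carrier (presented_group R)"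
  then show "X \<otimes>\<^bsub>presented_group R\<^esub> Y \<in> carrier (presented_group R)"
    by (auto simp: C mult_word_class)
  fix Z assume "Z \<in> carrier (presented_group R)"
  with \<open>X \<in> _\<close> \<open>Y \<in> _\<close> show "X \<otimes>\<^bsub>presented_group R\<^esub> Y \<otimes>\<^bsub>presented_group R\<^esub> Z
      = X \<otimes>\<^bsub>presented_group R\<^esub> (Y \<otimes>\<^bsub>presented_group R\<^esub> Z)"
    by (auto simp: C mult_word_class)
qed

datatype dihedral_gen = Gen_a | Gen_b

definition dihedral_relators :: "nat \<Rightarrow> dihedral_gen word set" where
  "dihedral_relators n =
     {replicate n (Gen_a, True),
      replicate 2 (Gen_b, True),
      concat (replicate 2 [(Gen_a, True), (Gen_b, True)])}"

definition dihedral_group :: "nat \<Rightarrow> dihedral_gen word set monoid" where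
  "dihedral_group n = presented_group (dihedral_relators n)"

definition dihedral_a :: "nat \<Rightarrow> dihedral_gen word set" where
  "dihedral_a n = word_class (dihedral_relators n) [(Gen_a, True)]"

definition dihedral_b :: "nat \<Rightarrow> dihedral_gen word set" where
  "dihedral_b n = word_class (dihedral_relators n) [(Gen_b, True)]"

record 'v graph =
  verts :: "'v set"
  edges :: "'v set set"

definition cayley_graph :: "('a, 'b) monoid_scheme \<Rightarrow> 'a set \<Rightarrow> 'a graph" where
  "cayley_graph D C =
     \<lparr>verts = carrier D,
      edges = {{x, y} | x y. x \<in> carrier D \<and> y \<in> carrier D \<and> x \<noteq> y \<and>
                 (inv\<^bsub>D\<^esub> x \<otimes>\<^bsub>D\<^esub> y \<in> C \<or> inv\<^bsub>D\<^esub> y \<otimes>\<^bsub>D\<^esub> x \<in> C)}\<rparr>"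

definition induced_subgraph :: "'v graph \<Rightarrow> 'v set \<Rightarrow> 'v graph" where
  "induced_subgraph G K = \<lparr>verts = verts G \<inter> K, edges = {e \<in> edges G. e \<subseteq> K}\<rparr>"

definition degree :: "'v graph \<Rightarrow> 'v \<Rightarrow> nat" where
  "degree G v = card {e \<in> edges G. v \<in> e}"

text \<open>The following three are only meaningful for finite graphs (and \<open>max_degree\<close> only for
  nonempty ones, \<open>sensitivity\<close> only if some vertex set exceeds the independence number).\<close>

definition max_degree :: "'v graph \<Rightarrow> nat" where
  "max_degree G = Max (degree G ` verts G)"

definition independence_number :: "'v graph \<Rightarrow> nat" where
  "independence_number G = Max {card S | S. S \<subseteq> verts G \<and> indep S (edges G)}"

definition sensitivity :: "'v graph \<Rightarrow> nat" where
  "sensitivity G =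
     Min {max_degree (induced_subgraph G K) | K. K \<subseteq> verts G \<and> card K > independence_number G}"

text \<open>A graph is a matching if its edges are pairwise disjoint and cover all of its vertices, i.e.
  it is a disjoint union of single edges without isolated vertices.\<close>

definition is_matching :: "'v graph \<Rightarrow> bool" where
  "is_matching G \<longleftrightarrow> pairwise disjnt (edges G) \<and> \<Union> (edges G) = verts G"

text \<open>The least significant nonzero digit of \<open>m\<close> in base 3; unspecified for \<open>m = 0\<close>.\<close>

definition rightmost_nonzero_digit3 :: "nat \<Rightarrow> nat" where
  "rightmost_nonzero_digit3 m = (let k = (LEAST k. m div 3 ^ k mod 3 \<noteq> 0) in m div 3 ^ k mod 3)"

end

theory Submission
  imports Defs
begin

text \<open>
  Every element of the dihedral group is \<open>a ^ i b ^ s\<close> with \<open>i\<close> unique modulo \<open>n\<close>, and the graph is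
  bipartite: \<open>a ^ i\<close> is adjacent to \<open>a ^ j b\<close> iff \<open>j - i\<close> is a power \<open>3 ^ k\<close> modulo \<open>n = 3 ^ d\<close>. If \<open>i\<close>
  has last nonzero ternary digit 1, then \<open>i + 3 ^ k\<close> has last nonzero digit 2 for exactly one \<open>k\<close>,
  the position of that digit; negation exchanges the digits 1 and 2 and gives the same from the other
  side. So the chosen vertices induce a matching. An independent set has at most \<open>n\<close> elements,
  because the edges \<open>{x, x b}\<close> partition the vertices; more than \<open>\<alpha>\<close> vertices always span an edge,
  so the sensitivity is at least 1, and the matching shows that it is at most 1.
\<close>

section \<open>Digits in base three\<close>

text \<open>An integer version of the last nonzero ternary digit, where \<open>c\<close> is meant to
  be 1 or 2. Integers allow negation, and the bound \<open>v < d\<close> makes the property depend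
  only on \<open>x\<close> modulo \<open>3 ^ d\<close>.\<close>

definition low_digit :: "nat \<Rightarrow> int \<Rightarrow> int \<Rightarrow> bool" where
  "low_digit d c x \<longleftrightarrow> (\<exists>v q. v < d \<and> x = 3 ^ v * (3 * q + c))"

lemma mod_3_unit_unique:
  fixes p q c c' :: int
  assumes "3 * p + c = 3 * q + c'" "c \<in> {0, 1, 2}" "c' \<in> {0, 1, 2}"
  shows "c = c'"
proof -
  have "c mod 3 = c' mod 3" by (metis assms(1) mod_mult_self4)
  then show ?thesis using assms(2,3) by auto
qed

text \<open>If the two exponents of 3 differed, cancelling the smaller power would equate a multiple
  of 3 with a number of nonzero residue. With equal exponents, the digits agree modulo 3.\<close>

lemma power3_times_unit_unique:
  fixes p q c c' :: int
  assumes eq: "3 ^ v * (3 * p + c) = 3 ^ w * (3 * q + c')"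
    and c: "c \<in> {1, 2}" "c' \<in> {1, 2}"
  shows "v = w \<and> c = c'"
proof -
  \<comment> \<open>Stated for arbitrary parameters so that it applies both to \<open>eq\<close> and
    to its mirror image.\<close>
  have ge: "v' \<le> w'"
    if eq: "3 ^ v' * (3 * p' + e) = 3 ^ w' * (3 * q' + e')" and e': "e' \<in> {1, 2}"
    for v' w' :: nat and p' q' e e' :: int
  proof (rule ccontr)
    assume "\<not> v' \<le> w'"
    then obtain m where "v' = w' + Suc m" using less_imp_Suc_add[of w' v'] by auto
    then have "3 ^ w' * (3 * (3 ^ m * (3 * p' + e))) = 3 ^ w' * (3 * q' + e')"
      using eq by (simp add: power_add algebra_simps)
    then have "3 * (3 ^ m * (3 * p' + e)) = 3 * q' + e'" by simp
    then show False using mod_3_unit_unique[of "3 ^ m * (3 * p' + e)" 0 q' e'] e' by auto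
  qed
  have "v = w" using ge[OF eq c(2)] ge[OF eq[symmetric] c(1)] by simp
  moreover from this eq have "3 * p + c = 3 * q + c'" by simp
  then have "c = c'" using mod_3_unit_unique[of p c q c'] c by auto
  ultimately show ?thesis by simp
qed

text \<open>The least position is \<open>v\<close>: dividing by a lower power \<open>3 ^ k\<close>
  leaves a multiple of 3.\<close>

lemma rightmost_nonzero_digit3_eq:
  assumes "m = 3 ^ v * (3 * q + c)" "c \<in> {1, 2}"
  shows "rightmost_nonzero_digit3 m = c"
proof -
  have "(LEAST k. m div 3 ^ k mod 3 \<noteq> 0) = v"
  proof (rule Least_equality)
    show "m div 3 ^ v mod 3 \<noteq> 0" using assms by auto
  next
    fix k assume k: "m div 3 ^ k mod 3 \<noteq> 0"
    show "v \<le> k"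
    proof (rule ccontr)
      assume "\<not> v \<le> k"
      then obtain j where "v = k + Suc j" using less_imp_Suc_add[of k v] by auto
      then have "m = 3 ^ k * (3 * (3 ^ j * (3 * q + c)))"
        using assms(1) by (simp add: power_add algebra_simps)
      then show False using k by simp
    qed
  qed
  then show ?thesis using assms by (auto simp: rightmost_nonzero_digit3_def)
qed

text \<open>Strong induction, dividing out one factor 3 at a time.\<close>

lemma nonzero_digit3_decomp:
  assumes "0 < (m :: nat)"
  obtains v q c where "m = 3 ^ v * (3 * q + c)" "c \<in> {1, 2}"
proof -
  have "\<exists>v q c. m = 3 ^ v * (3 * q + c) \<and> c \<in> {1, 2}" using assms
  proof (induction m rule: less_induct)
    case (less m)
    show ?case
    proof (cases "3 dvd m")
      case True
      then obtain k where k: "m = 3 * k" by auto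
      then have "k < m" "0 < k" using less.prems by auto
      then obtain v q c where "k = 3 ^ v * (3 * q + c)" "c \<in> {1, 2}" using less.IH by blast
      then have "m = 3 ^ Suc v * (3 * q + c)" using k by simp
      then show ?thesis using \<open>c \<in> _\<close> by blast
    next
      case False
      then have "m mod 3 \<in> {1, 2}" using mod_less_divisor[of 3 m] by (auto simp: dvd_eq_mod_eq_0)
      moreover have "m = 3 ^ 0 * (3 * (m div 3) + m mod 3)" by simp
      ultimately show ?thesis by blast
    qed
  qed
  then show thesis using that by blast
qed

lemma rightmost_nonzero_digit3_range:
  "0 < m \<Longrightarrow> rightmost_nonzero_digit3 m \<in> {1, 2}"
  by (metis nonzero_digit3_decomp rightmost_nonzero_digit3_eq)

text \<open>Links the integer predicate to the digit function. The bound \<open>m < 3 ^ d\<close>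
  places the digit below position \<open>d\<close>, because \<open>3 ^ v\<close> is at most
  \<open>m\<close>.\<close>

lemma low_digit_iff_rightmost:
  assumes "0 < m" "m < 3 ^ d" "c \<in> {1, 2}"
  shows "low_digit d (int c) (int m) \<longleftrightarrow> rightmost_nonzero_digit3 m = c"
proof -
  obtain v q e where m: "m = 3 ^ v * (3 * q + e)" "e \<in> {1, 2}"
    using nonzero_digit3_decomp[OF assms(1)] .
  then have mi: "int m = 3 ^ v * (3 * int q + int e)" by simp
  have "3 ^ v \<le> m" using m by auto
  then have "v < d" using assms(2) by (meson le_less_trans one_less_numeral_iff
      power_less_imp_less_exp semiring_norm(77))
  moreover have "rightmost_nonzero_digit3 m = e" using rightmost_nonzero_digit3_eq m by blast
  moreover have "int c = int e" if low: "low_digit d (int c) (int m)"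
  proof -
    obtain w p where "3 ^ v * (3 * int q + int e) = 3 ^ w * (3 * p + int c)"
      using low unfolding low_digit_def mi by blast
    then show ?thesis using power3_times_unit_unique[of v "int q" "int e" w p "int c"] assms(3) m(2)
      by auto
  qed
  ultimately show ?thesis using mi unfolding low_digit_def by auto
qed

section \<open>The last nonzero digit modulo \<open>3 ^ d\<close>\<close>

lemma low_digit_not_dvd: "low_digit d c x \<Longrightarrow> c \<in> {1, 2} \<Longrightarrow> \<not> 3 ^ d dvd x"
proof
  assume "low_digit d c x" and c: "c \<in> {1, 2}" and "3 ^ d dvd x"
  then obtain v q k where v: "v < d" and x: "x = 3 ^ v * (3 * q + c)" and k: "x = 3 ^ d * k"
    unfolding low_digit_def dvd_def by auto
  obtain m where "d = v + Suc m" using less_imp_Suc_add[OF v] by auto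
  with x k have "3 ^ v * (3 * q + c) = 3 ^ v * (3 * (3 ^ m * k))"
    by (simp add: power_add algebra_simps)
  then have "3 * q + c = 3 * (3 ^ m * k)" by simp
  then show False using mod_3_unit_unique[of q c "3 ^ m * k" 0] c by auto
qed

lemma low_digit_unique:
  "low_digit d c x \<Longrightarrow> low_digit d c' x \<Longrightarrow> c \<in> {1, 2} \<Longrightarrow> c' \<in> {1, 2} \<Longrightarrow> c = c'"
  unfolding low_digit_def using power3_times_unit_unique by blast

text \<open>As \<open>v < d\<close>, the number \<open>3 ^ d\<close> is a multiple of
  \<open>3 ^ Suc v\<close>, so only the quotient \<open>q\<close> changes.\<close>

lemma low_digit_add_multiple:
  assumes "low_digit d c x"
  shows "low_digit d c (x + 3 ^ d * k)"
proof -
  obtain v q where v: "v < d" and x: "x = 3 ^ v * (3 * q + c)"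
    using assms unfolding low_digit_def by auto
  obtain m where "d = v + Suc m" using less_imp_Suc_add[OF v] by auto
  then have "x + 3 ^ d * k = 3 ^ v * (3 * (q + 3 ^ m * k) + c)"
    by (simp add: x power_add algebra_simps)
  then show ?thesis using v unfolding low_digit_def by blast
qed

lemma low_digit_minus:
  assumes "low_digit d c x"
  shows "low_digit d (3 - c) (- x)"
proof -
  obtain v q where v: "v < d" and x: "x = 3 ^ v * (3 * q + c)"
    using assms unfolding low_digit_def by auto
  \<comment> \<open>A borrow from the higher digits: \<open>-(3 * q + c)\<close> is
    \<open>3 * (- q - 1) + (3 - c)\<close>.\<close>
  have "- x = 3 ^ v * (3 * (- q - 1) + (3 - c))" by (simp add: x algebra_simps)
  then show ?thesis using v unfolding low_digit_def by blast
qed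

text \<open>The exponents of the rotations (\<open>c = 1\<close>) or reflections
  (\<open>c = 2\<close>) in the vertex set \<open>M\<close>, as full residue classes. The multiples
  of \<open>3 ^ d\<close> account for the extra elements \<open>1\<close> and
  \<open>b\<close>.\<close>

definition digit_set :: "nat \<Rightarrow> int \<Rightarrow> int set" where
  "digit_set d c = {x. low_digit d c x \<or> 3 ^ d dvd x}"

lemma digit_set_cong:
  assumes "x \<in> digit_set d c" "3 ^ d dvd x - y"
  shows "y \<in> digit_set d c"
proof -
  obtain k where "x - y = 3 ^ d * k" using assms(2) by auto
  then have "y = x + 3 ^ d * (- k)" by simp
  then show ?thesis using assms low_digit_add_multiple[of d c x "- k"]
    by (auto simp: digit_set_def)
qed

lemma digit_set_minus: "x \<in> digit_set d c \<Longrightarrow> - x \<in> digit_set d (3 - c)"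
  using low_digit_minus by (auto simp: digit_set_def)

text \<open>Adding \<open>3 ^ k\<close> changes the last nonzero digit of \<open>x\<close> from 1 to 2 only at the position of
  that digit itself; at lower positions it creates a new last digit 1, and at higher ones it leaves
  the last digit alone. The multiples of \<open>3 ^ d\<close> behave as if that position were \<open>d\<close>.\<close>
lemma digit_set_add_power_ex1:
  assumes "x \<in> digit_set d 1"
  shows "\<exists>!k. k \<le> d \<and> x + 3 ^ k \<in> digit_set d 2"
proof (cases "3 ^ d dvd x")
  case True
  show ?thesis
  proof (rule ex1I[of _ d])
    show "d \<le> d \<and> x + 3 ^ d \<in> digit_set d 2" using True by (simp add: digit_set_def)
  next
    fix k assume k: "k \<le> d \<and> x + 3 ^ k \<in> digit_set d 2"
    show "k = d"
    proof (rule ccontr)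
      assume "k \<noteq> d"
      \<comment> \<open>Modulo \<open>3 ^ d\<close> the sum is just \<open>3 ^ k\<close>, whose last
        nonzero digit is 1 for \<open>k < d\<close>.\<close>
      then have "low_digit d 1 (3 ^ k)" using k unfolding low_digit_def
        by (intro exI[of _ k] exI[of _ 0]) auto
      moreover have "3 ^ k \<in> digit_set d 2"
        by (rule digit_set_cong[of "x + 3 ^ k"]) (use k True in auto)
      ultimately show False
        using low_digit_not_dvd[of d 1 "3 ^ k"] low_digit_unique[of d 1 "3 ^ k" 2]
        by (auto simp: digit_set_def)
    qed
  qed
next
  case False
  then obtain v q where v: "v < d" and x: "x = 3 ^ v * (3 * q + 1)"
    using assms unfolding low_digit_def digit_set_def by auto
  show ?thesis
  proof (rule ex1I[of _ v])
    have "x + 3 ^ v = 3 ^ v * (3 * q + 2)" by (simp add: x algebra_simps)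
    then show "v \<le> d \<and> x + 3 ^ v \<in> digit_set d 2"
      using v unfolding digit_set_def low_digit_def by auto
  next
    fix k assume k: "k \<le> d \<and> x + 3 ^ k \<in> digit_set d 2"
    show "k = v"
    proof (rule ccontr)
      assume "k \<noteq> v"
      have "low_digit d 1 (x + 3 ^ k)"
      proof (cases "k < v")
        case True
        then obtain m where "v = k + Suc m" using less_imp_Suc_add[OF True] by auto
        then have "x + 3 ^ k = 3 ^ k * (3 * (3 ^ m * (3 * q + 1)) + 1)"
          by (simp add: x power_add algebra_simps)
        then show ?thesis using True v unfolding low_digit_def by (metis less_trans)
      next
        case False
        then obtain m where "k = v + Suc m"
          using less_imp_Suc_add[of v k] \<open>k \<noteq> v\<close> by auto
        then have "x + 3 ^ k = 3 ^ v * (3 * (q + 3 ^ m) + 1)"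
          by (simp add: x power_add algebra_simps)
        then show ?thesis using v unfolding low_digit_def by blast
      qed
      then show False using k
        low_digit_not_dvd[of d 1 "x + 3 ^ k"] low_digit_unique[of d 1 "x + 3 ^ k" 2]
        by (auto simp: digit_set_def)
    qed
  qed
qed

text \<open>Negation swaps the two digit sets and turns subtraction of \<open>3 ^ k\<close> from
  \<open>y\<close> into its addition to \<open>- y\<close>.\<close>

lemma digit_set_diff_power_ex1:
  assumes "y \<in> digit_set d 2"
  shows "\<exists>!k. k \<le> d \<and> y - 3 ^ k \<in> digit_set d 1"
proof -
  have "y - 3 ^ k \<in> digit_set d 1 \<longleftrightarrow> - y + 3 ^ k \<in> digit_set d 2" for k
    using digit_set_minus[of "y - 3 ^ k" d 1] digit_set_minus[of "- y + 3 ^ k" d 2] by auto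
  then show ?thesis
    using digit_set_add_power_ex1[of "- y" d] digit_set_minus[OF assms] by simp
qed

section \<open>Normal forms in the dihedral group\<close>

text \<open>Reading a word from left to right while keeping it in the form \<open>a ^ i b ^ s\<close>:
  \<open>word_flip u s\<close> is the final value of \<open>s\<close> and \<open>word_shift u s\<close> the total change of \<open>i\<close>,
  when the reading starts with the value \<open>s\<close>.\<close>

fun word_flip :: "dihedral_gen word \<Rightarrow> bool \<Rightarrow> bool" where
  "word_flip [] s = s"
| "word_flip ((Gen_a, e) # u) s = word_flip u s"
| "word_flip ((Gen_b, e) # u) s = word_flip u (\<not> s)"

fun word_shift :: "dihedral_gen word \<Rightarrow> bool \<Rightarrow> int" where
  "word_shift [] s = 0"
| "word_shift ((Gen_a, e) # u) s = (if e = s then - 1 else 1) + word_shift u s"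
| "word_shift ((Gen_b, e) # u) s = word_shift u (\<not> s)"

lemma word_flip_append: "word_flip (u @ v) s = word_flip v (word_flip u s)"
  by (induction u s rule: word_flip.induct) auto

lemma word_shift_append:
  "word_shift (u @ v) s = word_shift u s + word_shift v (word_flip u s)"
  by (induction u s rule: word_flip.induct) auto

lemma word_replicate_a:
  "word_flip (replicate m (Gen_a, True)) s = s"
  "word_shift (replicate m (Gen_a, True)) s = (if s then - int m else int m)"
  by (induction m) auto

text \<open>The relator \<open>a ^ n\<close> shifts by \<open>n\<close> or \<open>- n\<close>,
  \<open>b ^ 2\<close> does not shift, and in \<open>(a b) ^ 2\<close> the two letters
  \<open>a\<close> are read with opposite values of \<open>s\<close>, so their shifts
  cancel.\<close>

lemma dihedral_relator_invariant:
  assumes "r \<in> dihedral_relators n"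
  shows "word_flip r s = s" "int n dvd word_shift r s"
  using assms by (auto simp: dihedral_relators_def word_replicate_a numeral_2_eq_2)

text \<open>The final flip and the shift modulo \<open>n\<close> are invariants of the presentation;
  they later show that distinct normal forms are distinct group elements.\<close>

lemma word_eq_dihedral_invariant:
  "word_eq (dihedral_relators n) u v \<Longrightarrow>
     word_flip u s = word_flip v s \<and> int n dvd word_shift u s - word_shift v s"
proof (induction rule: word_eq.induct)
  case (sym u v)
  then show ?case by (simp add: dvd_diff_commute)
next
  case (trans u v w)
  then show ?case
    using dvd_add[of "int n" "word_shift u s - word_shift v s" "word_shift v s - word_shift w s"]
    by simp
next
  case (cancel u x e v)
  then show ?case by (cases x) (auto simp: word_flip_append word_shift_append)
next
  case (relator r u v)
  then show ?case
    by (simp add: word_flip_append word_shift_append dihedral_relator_invariant)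
qed simp

text \<open>The normal form with an integer exponent, so that products and inverses need no
  reduction modulo \<open>n\<close>.\<close>

definition dihedral_elem :: "nat \<Rightarrow> int \<Rightarrow> bool \<Rightarrow> dihedral_gen word set" where
  "dihedral_elem n i s =
     dihedral_a n [^]\<^bsub>dihedral_group n\<^esub> i \<otimes>\<^bsub>dihedral_group n\<^esub>
       (if s then dihedral_b n else \<one>\<^bsub>dihedral_group n\<^esub>)"

lemma group_dihedral: "group (dihedral_group n)"
  by (simp add: dihedral_group_def group_presented_group)

lemma dihedral_generators_closed:
  "dihedral_a n \<in> carrier (dihedral_group n)" "dihedral_b n \<in> carrier (dihedral_group n)"
  by (simp_all add: dihedral_group_def presented_group_def dihedral_a_def dihedral_b_def)

lemma mult_dihedral_class:
  "word_class (dihedral_relators n) u \<otimes>\<^bsub>dihedral_group n\<^esub> word_class (dihedral_relators n) v =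
     word_class (dihedral_relators n) (u @ v)"
  by (simp add: dihedral_group_def mult_word_class)

lemma one_dihedral_class: "\<one>\<^bsub>dihedral_group n\<^esub> = word_class (dihedral_relators n) []"
  by (simp add: dihedral_group_def presented_group_def)

lemma dihedral_a_nat_pow:
  "dihedral_a n [^]\<^bsub>dihedral_group n\<^esub> (m :: nat) =
     word_class (dihedral_relators n) (replicate m (Gen_a, True))"
proof (induction m)
  case 0
  interpret group "dihedral_group n" by (rule group_dihedral)
  show ?case by (simp add: one_dihedral_class)
next
  case (Suc m)
  interpret group "dihedral_group n" by (rule group_dihedral)
  show ?case
    using Suc by (simp add: dihedral_a_def mult_dihedral_class replicate_append_same)
qed

lemma dihedral_relations:
  fixes n :: nat
  defines "D \<equiv> dihedral_group n"
  shows "dihedral_a n [^]\<^bsub>D\<^esub> n = \<one>\<^bsub>D\<^esub>"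
    and "dihedral_b n \<otimes>\<^bsub>D\<^esub> dihedral_b n = \<one>\<^bsub>D\<^esub>"
    and "(dihedral_a n \<otimes>\<^bsub>D\<^esub> dihedral_b n) \<otimes>\<^bsub>D\<^esub> (dihedral_a n \<otimes>\<^bsub>D\<^esub> dihedral_b n) = \<one>\<^bsub>D\<^esub>"
proof -
  have rel: "word_class (dihedral_relators n) r = word_class (dihedral_relators n) []"
    if "r \<in> dihedral_relators n" for r
    using word_eq.relator[OF that, of "[]" "[]"] by (simp add: word_class_eq_iff)
  show "dihedral_a n [^]\<^bsub>D\<^esub> n = \<one>\<^bsub>D\<^esub>"
    unfolding D_def dihedral_a_nat_pow one_dihedral_class
    by (rule rel) (simp add: dihedral_relators_def)
  show "dihedral_b n \<otimes>\<^bsub>D\<^esub> dihedral_b n = \<one>\<^bsub>D\<^esub>"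
    unfolding D_def dihedral_b_def mult_dihedral_class one_dihedral_class
    by (rule rel) (simp add: dihedral_relators_def numeral_2_eq_2)
  show "(dihedral_a n \<otimes>\<^bsub>D\<^esub> dihedral_b n) \<otimes>\<^bsub>D\<^esub> (dihedral_a n \<otimes>\<^bsub>D\<^esub> dihedral_b n) = \<one>\<^bsub>D\<^esub>"
    unfolding D_def dihedral_a_def dihedral_b_def mult_dihedral_class one_dihedral_class
    by (rule rel) (simp add: dihedral_relators_def numeral_2_eq_2)
qed

text \<open>Conjugation is an endomorphism, hence commutes with powers.\<close>

lemma (in group) conj_int_pow:
  assumes "x \<in> carrier G" "y \<in> carrier G"
  shows "y \<otimes> x [^] (i :: int) \<otimes> inv y = (y \<otimes> x \<otimes> inv y) [^] i"
proof -
  have "(\<lambda>z. y \<otimes> z \<otimes> inv y) \<in> hom G G"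
    using assms(2) by (auto intro!: homI simp: m_assoc inv_solve_left)
  then show ?thesis by (rule hom_int_pow) (use assms is_group in auto)
qed

text \<open>The relations make conjugation by \<open>b\<close> invert \<open>a\<close>, and hence
  every power of \<open>a\<close>.\<close>

lemma dihedral_b_int_pow:
  fixes n :: nat
  defines "D \<equiv> dihedral_group n"
  shows "dihedral_b n \<otimes>\<^bsub>D\<^esub> dihedral_a n [^]\<^bsub>D\<^esub> (i :: int) =
     dihedral_a n [^]\<^bsub>D\<^esub> (- i) \<otimes>\<^bsub>D\<^esub> dihedral_b n"
proof -
  interpret group D unfolding D_def by (rule group_dihedral)
  let ?a = "dihedral_a n" and ?b = "dihedral_b n"
  have [simp]: "?a \<in> carrier D" "?b \<in> carrier D"
    unfolding D_def by (rule dihedral_generators_closed)+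
  have b: "?b \<otimes>\<^bsub>D\<^esub> ?b = \<one>\<^bsub>D\<^esub>" unfolding D_def by (rule dihedral_relations)
  then have invb: "inv\<^bsub>D\<^esub> ?b = ?b" by (simp add: inv_equality)
  have "(?a \<otimes>\<^bsub>D\<^esub> ?b) \<otimes>\<^bsub>D\<^esub> (?a \<otimes>\<^bsub>D\<^esub> ?b) = \<one>\<^bsub>D\<^esub>" unfolding D_def by (rule dihedral_relations)
  \<comment> \<open>A cyclic rotation of the relation: a left inverse is also a right
    inverse.\<close>
  then have "(?b \<otimes>\<^bsub>D\<^esub> ?a \<otimes>\<^bsub>D\<^esub> ?b) \<otimes>\<^bsub>D\<^esub> ?a = \<one>\<^bsub>D\<^esub>"
    by (metis \<open>?a \<in> carrier D\<close> \<open>?b \<in> carrier D\<close> inv_comm m_assoc m_closed)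
  then have "?b \<otimes>\<^bsub>D\<^esub> ?a \<otimes>\<^bsub>D\<^esub> inv\<^bsub>D\<^esub> ?b = inv\<^bsub>D\<^esub> ?a" by (simp add: invb inv_equality)
  then have "?b \<otimes>\<^bsub>D\<^esub> ?a [^]\<^bsub>D\<^esub> i \<otimes>\<^bsub>D\<^esub> inv\<^bsub>D\<^esub> ?b = ?a [^]\<^bsub>D\<^esub> (- i)"
    using conj_int_pow[of ?a ?b i] by (simp add: int_pow_inv int_pow_neg)
  then show ?thesis by (simp add: invb b m_assoc flip: inv_solve_right')
qed

section \<open>Arithmetic and uniqueness of the normal forms\<close>

lemma dihedral_elem_closed: "dihedral_elem n i s \<in> carrier (dihedral_group n)"
proof -
  interpret group "dihedral_group n" by (rule group_dihedral)
  show ?thesis by (simp add: dihedral_elem_def dihedral_generators_closed)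
qed

text \<open>Moving \<open>a ^ j\<close> to the left past \<open>b\<close> changes its sign, and
  \<open>b\<close> squares to the identity.\<close>

lemma dihedral_elem_mult:
  "dihedral_elem n i s \<otimes>\<^bsub>dihedral_group n\<^esub> dihedral_elem n j t =
     dihedral_elem n (if s then i - j else i + j) (s \<noteq> t)"
proof -
  define D where "D = dihedral_group n"
  interpret group D unfolding D_def by (rule group_dihedral)
  let ?a = "dihedral_a n" and ?b = "dihedral_b n"
  have [simp]: "?a \<in> carrier D" "?b \<in> carrier D"
    unfolding D_def by (rule dihedral_generators_closed)+
  have b: "?b \<otimes>\<^bsub>D\<^esub> ?b = \<one>\<^bsub>D\<^esub>" unfolding D_def by (rule dihedral_relations)
  define z where "z = (if t then ?b else \<one>\<^bsub>D\<^esub>)"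
  have [simp]: "z \<in> carrier D" by (simp add: z_def)
  show ?thesis
  proof (cases s)
    case True
    have "?a [^]\<^bsub>D\<^esub> i \<otimes>\<^bsub>D\<^esub> ?b \<otimes>\<^bsub>D\<^esub> (?a [^]\<^bsub>D\<^esub> j \<otimes>\<^bsub>D\<^esub> z)
        = ?a [^]\<^bsub>D\<^esub> i \<otimes>\<^bsub>D\<^esub> (?b \<otimes>\<^bsub>D\<^esub> ?a [^]\<^bsub>D\<^esub> j) \<otimes>\<^bsub>D\<^esub> z"
      by (simp add: m_assoc)
    also have "\<dots> = ?a [^]\<^bsub>D\<^esub> i \<otimes>\<^bsub>D\<^esub> ?a [^]\<^bsub>D\<^esub> (- j) \<otimes>\<^bsub>D\<^esub> (?b \<otimes>\<^bsub>D\<^esub> z)"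
      using dihedral_b_int_pow[of n j, folded D_def] by (simp add: m_assoc)
    also have "\<dots> = ?a [^]\<^bsub>D\<^esub> (i - j) \<otimes>\<^bsub>D\<^esub> (?b \<otimes>\<^bsub>D\<^esub> z)"
      using int_pow_mult[of ?a i "- j"] by simp
    finally show ?thesis using True b by (auto simp: dihedral_elem_def z_def simp flip: D_def)
  next
    case False
    then show ?thesis
      by (auto simp: dihedral_elem_def m_assoc int_pow_mult simp flip: D_def)
  qed
qed

lemma dihedral_elem_basic:
  "\<one>\<^bsub>dihedral_group n\<^esub> = dihedral_elem n 0 False"
  "dihedral_a n [^]\<^bsub>dihedral_group n\<^esub> i = dihedral_elem n i False"
  "dihedral_a n [^]\<^bsub>dihedral_group n\<^esub> (m :: nat) = dihedral_elem n (int m) False"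
  "dihedral_b n = dihedral_elem n 0 True"
proof -
  interpret group "dihedral_group n" by (rule group_dihedral)
  show "\<one>\<^bsub>dihedral_group n\<^esub> = dihedral_elem n 0 False"
    "dihedral_a n [^]\<^bsub>dihedral_group n\<^esub> i = dihedral_elem n i False"
    "dihedral_a n [^]\<^bsub>dihedral_group n\<^esub> m = dihedral_elem n (int m) False"
    "dihedral_b n = dihedral_elem n 0 True"
    by (simp_all add: dihedral_elem_def dihedral_generators_closed int_pow_int)
qed

lemma dihedral_elem_inv:
  "inv\<^bsub>dihedral_group n\<^esub> dihedral_elem n i s = dihedral_elem n (if s then i else - i) s"
proof -
  interpret group "dihedral_group n" by (rule group_dihedral)
  show ?thesis
    by (rule inv_equality)
      (auto simp: dihedral_elem_mult dihedral_elem_closed dihedral_elem_basic(1))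
qed

lemma dihedral_elem_period: "dihedral_elem n (int n * k) False = \<one>\<^bsub>dihedral_group n\<^esub>"
proof -
  interpret group "dihedral_group n" by (rule group_dihedral)
  have "dihedral_a n [^]\<^bsub>dihedral_group n\<^esub> (int n * k) = \<one>\<^bsub>dihedral_group n\<^esub>"
    by (simp add: dihedral_generators_closed int_pow_pow[symmetric] int_pow_int
        dihedral_relations int_pow_one)
  then show ?thesis by (simp add: dihedral_elem_basic(2))
qed

text \<open>The relation \<open>a ^ n = 1\<close> identifies congruent exponents; the word
  invariants show that nothing else collapses in the presented group.\<close>

lemma dihedral_elem_eq_iff:
  assumes "0 < n"
  shows "dihedral_elem n i s = dihedral_elem n j t \<longleftrightarrow> s = t \<and> int n dvd i - j"
proof -
  interpret group "dihedral_group n" by (rule group_dihedral)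
  have shift: "dihedral_elem n (i + int n * k) s = dihedral_elem n i s" for i k s
    using dihedral_elem_mult[of n "int n * k" False i s]
    by (simp add: dihedral_elem_period dihedral_elem_closed add.commute)
  \<comment> \<open>A natural exponent gives an explicit representing word, to which the invariants
    apply.\<close>
  have norm: "dihedral_elem n i s = dihedral_elem n (int (nat (i mod int n))) s" for i s
    using shift[of "i mod int n" "i div int n" s] assms by simp
  have cls: "dihedral_elem n (int m) s = word_class (dihedral_relators n)
      (replicate m (Gen_a, True) @ (if s then [(Gen_b, True)] else []))" for m s
    by (simp add: dihedral_elem_def int_pow_int dihedral_a_nat_pow dihedral_b_def
        mult_dihedral_class one_dihedral_class)
  show ?thesis
  proof
    assume "dihedral_elem n i s = dihedral_elem n j t"
    then have "word_eq (dihedral_relators n)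
        (replicate (nat (i mod int n)) (Gen_a, True) @ (if s then [(Gen_b, True)] else []))
        (replicate (nat (j mod int n)) (Gen_a, True) @ (if t then [(Gen_b, True)] else []))"
      unfolding norm[of i s] norm[of j t] cls word_class_eq_iff .
    \<comment> \<open>Read from the value \<open>False\<close>, each letter \<open>a\<close> counts
      as \<open>+1\<close>, so the shift is the exponent.\<close>
    from word_eq_dihedral_invariant[OF this, of False]
    have "s = t" "int n dvd i mod int n - j mod int n"
      using assms by (auto simp: word_flip_append word_shift_append word_replicate_a split: if_splits)
    then show "s = t \<and> int n dvd i - j"
      by (simp add: mod_eq_dvd_iff[symmetric])
  next
    assume "s = t \<and> int n dvd i - j"
    then obtain k where "s = t" "i - j = int n * k" by auto
    then show "dihedral_elem n i s = dihedral_elem n j t"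
      using shift[of j k s] by (simp add: algebra_simps)
  qed
qed

text \<open>Each letter has a normal form, an inverse letter being the inverse of its generator, and
  normal forms are closed under products.\<close>

lemma word_class_dihedral_elem: "\<exists>i s. word_class (dihedral_relators n) u = dihedral_elem n i s"
proof (induction u)
  case Nil
  show ?case using dihedral_elem_basic(1)[of n] by (auto simp: one_dihedral_class)
next
  case (Cons l u)
  interpret group "dihedral_group n" by (rule group_dihedral)
  obtain x e where l: "l = (x, e)" by (cases l)
  have gen: "\<exists>i s. word_class (dihedral_relators n) [(x, True)] = dihedral_elem n i s"
    using dihedral_elem_basic(2)[of n 1] dihedral_elem_basic(4)[of n] dihedral_generators_closed
    by (cases x) (auto simp: dihedral_a_def[symmetric] dihedral_b_def[symmetric])
  have "\<exists>i s. word_class (dihedral_relators n) [(x, e)] = dihedral_elem n i s"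
  proof (cases e)
    case False
    from gen obtain i s where i: "word_class (dihedral_relators n) [(x, True)] = dihedral_elem n i s"
      by blast
    have "word_class (dihedral_relators n) [(x, False)] =
        inv\<^bsub>dihedral_group n\<^esub> word_class (dihedral_relators n) [(x, True)]"
      using word_eq.cancel[of "dihedral_relators n" "[]" x False "[]"]
      by (intro inv_equality[symmetric])
        (simp_all add: mult_dihedral_class one_dihedral_class word_class_eq_iff,
          simp_all add: dihedral_group_def presented_group_def)
    then have "word_class (dihedral_relators n) [(x, e)] = dihedral_elem n (if s then i else - i) s"
      unfolding i dihedral_elem_inv using False by simp
    then show ?thesis by blast
  qed (use gen in simp)
  then obtain i s where "word_class (dihedral_relators n) [(x, e)] = dihedral_elem n i s" by blast
  moreover obtain j t where "word_class (dihedral_relators n) u = dihedral_elem n j t"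
    using Cons by blast
  moreover have "word_class (dihedral_relators n) (l # u) = word_class (dihedral_relators n) [(x, e)]
      \<otimes>\<^bsub>dihedral_group n\<^esub> word_class (dihedral_relators n) u"
    by (simp add: mult_dihedral_class l)
  ultimately have "word_class (dihedral_relators n) (l # u) =
      dihedral_elem n (if s then i - j else i + j) (s \<noteq> t)" by (simp only: dihedral_elem_mult)
  then show ?case by blast
qed

lemma carrier_dihedral: "carrier (dihedral_group n) = range (\<lambda>(i, s). dihedral_elem n i s)"
  using word_class_dihedral_elem dihedral_elem_closed
  by (fastforce simp: dihedral_group_def presented_group_def)

lemma card_carrier_dihedral:
  assumes "0 < n"
  shows "card (carrier (dihedral_group n)) = 2 * n"
proof -
  have "carrier (dihedral_group n) =
      (\<lambda>(i, s). dihedral_elem n (int i) s) ` ({..<n} \<times> UNIV)" (is "_ = ?R")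
  proof
    show "carrier (dihedral_group n) \<subseteq> ?R"
    proof
      fix x assume "x \<in> carrier (dihedral_group n)"
      then obtain i s where "x = dihedral_elem n i s" by (auto simp: carrier_dihedral)
      moreover have "dihedral_elem n i s = dihedral_elem n (int (nat (i mod int n))) s"
        using assms by (simp add: dihedral_elem_eq_iff mod_eq_dvd_iff[symmetric])
      moreover have "nat (i mod int n) < n" using assms by (simp add: nat_less_iff)
      ultimately show "x \<in> ?R" by force
    qed
  qed (auto simp: dihedral_elem_closed)
  moreover have "inj_on (\<lambda>(i, s). dihedral_elem n (int i) s) ({..<n} \<times> UNIV)"
    using assms by (auto simp: inj_on_def dihedral_elem_eq_iff mod_eq_dvd_iff[symmetric])
  ultimately show ?thesis by (simp add: card_image card_cartesian_product)
qed

section \<open>Sensitivity of graphs\<close>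

text \<open>Covering gives each vertex an edge, and disjointness makes it the only one.\<close>

lemma max_degree_matching:
  assumes "is_matching H" "finite (verts H)" "verts H \<noteq> {}"
  shows "max_degree H = 1"
proof -
  have "degree H v = 1" if "v \<in> verts H" for v
  proof -
    have "v \<in> \<Union> (edges H)" using that assms(1) by (simp add: is_matching_def)
    then obtain e where e: "e \<in> edges H" "v \<in> e" by (rule UnionE)
    then have "{e \<in> edges H. v \<in> e} = {e}"
      using assms(1) by (auto simp: is_matching_def pairwise_def disjnt_def)
    then show ?thesis by (simp add: degree_def)
  qed
  then have "degree H ` verts H = {1}" using assms(3) by force
  then show ?thesis by (simp add: max_degree_def)
qed

text \<open>\<open>M\<close> attains the value 1, and every competing vertex set spans an edge,
  whose ends have degree at least 1.\<close>

lemma sensitivity_eq_1: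
  assumes fin: "finite (verts G)"
    and M: "M \<subseteq> verts G" "independence_number G < card M" "is_matching (induced_subgraph G M)"
  shows "sensitivity G = 1"
proof -
  let ?S = "{max_degree (induced_subgraph G K) | K. K \<subseteq> verts G \<and> card K > independence_number G}"
  have "?S \<subseteq> (\<lambda>K. max_degree (induced_subgraph G K)) ` Pow (verts G)" by auto
  then have finS: "finite ?S" using fin by (meson finite_Pow_iff finite_imageI finite_subset)
  have "verts (induced_subgraph G M) = M" using M(1) by (auto simp: induced_subgraph_def)
  moreover have "M \<noteq> {}" using M(2) by auto
  ultimately have "max_degree (induced_subgraph G M) = 1"
    using max_degree_matching[OF M(3)] fin M(1) finite_subset by auto
  then have "1 \<in> ?S" using M(1,2) by (intro CollectI exI[of _ M]) simp
  moreover have "1 \<le> max_degree (induced_subgraph G K)"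
    if K: "K \<subseteq> verts G" "card K > independence_number G" for K
  proof -
    have finK: "finite K" using K(1) fin finite_subset by blast
    have "\<not> indep K (edges G)"
    proof
      assume "indep K (edges G)"
      moreover have "{card S | S. S \<subseteq> verts G \<and> indep S (edges G)} \<subseteq> card ` Pow (verts G)" by auto
      then have "finite {card S | S. S \<subseteq> verts G \<and> indep S (edges G)}"
        using fin by (meson finite_Pow_iff finite_imageI finite_subset)
      ultimately have "card K \<le> independence_number G"
        unfolding independence_number_def using K(1) by (intro Max_ge) auto
      then show False using K(2) by simp
    qed
    then obtain v w where vw: "v \<in> K" "w \<in> K" "{v, w} \<in> edges G"
      unfolding indep_def by auto
    let ?E = "{e \<in> edges (induced_subgraph G K). v \<in> e}"
    have "{v, w} \<in> ?E" using vw by (simp add: induced_subgraph_def)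
    \<comment> \<open>Finiteness matters for the degree bound, since \<open>card\<close> is 0 on
      infinite sets.\<close>
    moreover have "?E \<subseteq> Pow K" by (auto simp: induced_subgraph_def)
    then have "finite ?E" using finK finite_subset by blast
    ultimately have "1 \<le> degree (induced_subgraph G K) v"
      unfolding degree_def by (metis One_nat_def Suc_leI card_gt_0_iff empty_iff)
    also have "\<dots> \<le> max_degree (induced_subgraph G K)"
      unfolding max_degree_def using vw K(1) finK
      by (intro Max_ge) (auto simp: induced_subgraph_def)
    finally show ?thesis .
  qed
  then have "\<And>y. y \<in> ?S \<Longrightarrow> 1 \<le> y" by blast
  ultimately show ?thesis unfolding sensitivity_def using finS by (intro Min_eqI) auto
qed

text \<open>An element \<open>b\<close> of the connection set pairs the group into edges \<open>{x, x b}\<close>, and an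
  independent set contains at most one end of each.\<close>
lemma independence_number_cayley_le:
  assumes D: "group D" and fin: "finite (carrier D)"
    and b: "b \<in> C" "b \<in> carrier D" "b \<noteq> \<one>\<^bsub>D\<^esub>"
  shows "2 * independence_number (cayley_graph D C) \<le> card (carrier D)"
proof -
  interpret group D by (rule D)
  let ?G = "cayley_graph D C"
  let ?S = "{card S | S. S \<subseteq> verts ?G \<and> indep S (edges ?G)}"
  have "?S \<subseteq> card ` Pow (carrier D)" by (auto simp: cayley_graph_def)
  then have "finite ?S" using fin by (meson finite_Pow_iff finite_imageI finite_subset)
  \<comment> \<open>The empty set makes the family nonempty, so the maximum is attained by some
    \<open>S\<close>.\<close>
  moreover have "indep {} (edges ?G)" by (simp add: indep_def)
  then have "?S \<noteq> {}" by blast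
  ultimately have "independence_number ?G \<in> ?S" unfolding independence_number_def by (rule Max_in)
  then obtain S where S: "independence_number ?G = card S" "S \<subseteq> carrier D" "indep S (edges ?G)"
    by (auto simp: cayley_graph_def)
  let ?T = "(\<lambda>x. x \<otimes>\<^bsub>D\<^esub> b) ` S"
  have "inj_on (\<lambda>x. x \<otimes>\<^bsub>D\<^esub> b) S" using S(2) b(2) by (auto simp: inj_on_def subset_iff)
  then have "card ?T = card S" by (rule card_image)
  moreover have "S \<inter> ?T = {}"
  proof (rule ccontr)
    assume "S \<inter> ?T \<noteq> {}"
    then obtain x where x: "x \<in> S" "x \<otimes>\<^bsub>D\<^esub> b \<in> S" by auto
    then have xc: "x \<in> carrier D" using S(2) by auto
    have ne: "x \<noteq> x \<otimes>\<^bsub>D\<^esub> b" using l_cancel_one'[of x b] b xc by simp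
    have "inv\<^bsub>D\<^esub> x \<otimes>\<^bsub>D\<^esub> (x \<otimes>\<^bsub>D\<^esub> b) = b" using xc b(2) by (simp add: inv_solve_left')
    then have "{x, x \<otimes>\<^bsub>D\<^esub> b} \<in> edges ?G"
      unfolding cayley_graph_def graph.simps mem_Collect_eq
      by (intro exI[of _ x] exI[of _ "x \<otimes>\<^bsub>D\<^esub> b"]) (use xc b ne in simp)
    then show False using S(3) x ne unfolding indep_def by auto
  qed
  moreover have "finite S" using S(2) fin finite_subset by blast
  ultimately have "2 * card S = card (S \<union> ?T)" by (simp add: card_Un_disjoint)
  also have "\<dots> \<le> card (carrier D)" using S(2) b(2) fin by (intro card_mono) auto
  finally show ?thesis using S(1) by simp
qed

section \<open>The Cayley graph\<close>

text \<open>The connection set contains only reflections, so each edge joins a rotation to a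
  reflection. Reflections are their own inverses, so both orientations give the same
  condition.\<close>

lemma edges_cayley_dihedral:
  assumes "0 < n"
  shows "edges (cayley_graph (dihedral_group n) ((\<lambda>k. dihedral_elem n k True) ` K)) =
     {{dihedral_elem n i False, dihedral_elem n (i + k) True} | i k. k \<in> K}"
    (is "edges ?G = ?R")
proof
  let ?D = "dihedral_group n" and ?C = "(\<lambda>k. dihedral_elem n k True) ` K"
  have adj: "{dihedral_elem n i s, dihedral_elem n j t} \<in> ?R"
    if C: "inv\<^bsub>?D\<^esub> dihedral_elem n i s \<otimes>\<^bsub>?D\<^esub> dihedral_elem n j t \<in> ?C" for i j s t
  proof -
    from C obtain k where k: "k \<in> K"
      and "dihedral_elem n (if s then i - j else j - i) (s \<noteq> t) = dihedral_elem n k True"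
      by (cases s) (auto simp: dihedral_elem_inv dihedral_elem_mult)
    then have st: "t = (\<not> s)" and dv: "int n dvd (if s then i - j else j - i) - k"
      using assms by (auto simp: dihedral_elem_eq_iff)
    show ?thesis
    proof (cases s)
      case True
      then have "dihedral_elem n i s = dihedral_elem n (j + k) True"
        using assms dv by (simp add: dihedral_elem_eq_iff algebra_simps)
      then show ?thesis using k st True by auto
    next
      case False
      then have "dihedral_elem n j t = dihedral_elem n (i + k) True"
        using assms dv st by (simp add: dihedral_elem_eq_iff algebra_simps)
      then show ?thesis using k st False by auto
    qed
  qed
  show "edges ?G \<subseteq> ?R"
  proof
    fix e assume "e \<in> edges ?G"
    then obtain x y where e: "e = {x, y}" and xy: "x \<in> carrier ?D" "y \<in> carrier ?D"
      and "inv\<^bsub>?D\<^esub> x \<otimes>\<^bsub>?D\<^esub> y \<in> ?C \<or> inv\<^bsub>?D\<^esub> y \<otimes>\<^bsub>?D\<^esub> x \<in> ?C"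
      by (auto simp: cayley_graph_def)
    moreover obtain i s j t where "x = dihedral_elem n i s" "y = dihedral_elem n j t"
      using xy by (auto simp: carrier_dihedral)
    ultimately show "e \<in> ?R" using adj[of i s j t] adj[of j t i s] by (metis insert_commute)
  qed
  show "?R \<subseteq> edges ?G"
  proof
    fix e assume "e \<in> ?R"
    then obtain i k where e: "e = {dihedral_elem n i False, dihedral_elem n (i + k) True}"
      and k: "k \<in> K" by auto
    have "inv\<^bsub>?D\<^esub> dihedral_elem n i False \<otimes>\<^bsub>?D\<^esub> dihedral_elem n (i + k) True \<in> ?C"
      using k by (simp add: dihedral_elem_inv dihedral_elem_mult)
    then show "e \<in> edges ?G"
      unfolding cayley_graph_def graph.simps mem_Collect_eq e
      by (intro exI[of _ "dihedral_elem n i False"] exI[of _ "dihedral_elem n (i + k) True"])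
        (use assms in \<open>simp add: dihedral_elem_closed dihedral_elem_eq_iff\<close>)
  qed
qed

section \<open>The graph for \<open>n = 3 ^ d\<close> and its induced matching\<close>

definition power3_graph :: "nat \<Rightarrow> dihedral_gen word set graph" where
  "power3_graph d = cayley_graph (dihedral_group (3 ^ d))
     ((\<lambda>k. dihedral_elem (3 ^ d) k True) ` ((^) 3 ` {..d}))"

definition digit_vertices :: "nat \<Rightarrow> dihedral_gen word set set" where
  "digit_vertices d = (\<lambda>i. dihedral_elem (3 ^ d) i False) ` digit_set d 1 \<union>
     (\<lambda>i. dihedral_elem (3 ^ d) i True) ` digit_set d 2"

text \<open>Membership can be read off any exponent because the digit sets are unions of residue
  classes modulo \<open>3 ^ d\<close> and no rotation is a reflection.\<close>

lemma elem_in_digit_vertices_iff: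
  "dihedral_elem (3 ^ d) i False \<in> digit_vertices d \<longleftrightarrow> i \<in> digit_set d 1"
  "dihedral_elem (3 ^ d) i True \<in> digit_vertices d \<longleftrightarrow> i \<in> digit_set d 2"
proof -
  have own: "dihedral_elem (3 ^ d) i s \<in> (\<lambda>i. dihedral_elem (3 ^ d) i s) ` digit_set d c
      \<longleftrightarrow> i \<in> digit_set d c" for i s c
  proof
    assume "dihedral_elem (3 ^ d) i s \<in> (\<lambda>i. dihedral_elem (3 ^ d) i s) ` digit_set d c"
    then obtain j where "j \<in> digit_set d c" "3 ^ d dvd j - i"
      by (auto simp: dihedral_elem_eq_iff dvd_diff_commute)
    then show "i \<in> digit_set d c" by (rule digit_set_cong)
  qed (rule imageI)
  have other: "dihedral_elem (3 ^ d) i s \<notin> (\<lambda>i. dihedral_elem (3 ^ d) i (\<not> s)) ` X" for i s X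
    by (auto simp: dihedral_elem_eq_iff)
  show "dihedral_elem (3 ^ d) i False \<in> digit_vertices d \<longleftrightarrow> i \<in> digit_set d 1"
    "dihedral_elem (3 ^ d) i True \<in> digit_vertices d \<longleftrightarrow> i \<in> digit_set d 2"
    using own[of i False 1] own[of i True 2] other[of i False] other[of i True]
    by (simp_all add: digit_vertices_def)
qed

lemma edges_induced_digit_vertices:
  "edges (induced_subgraph (power3_graph d) (digit_vertices d)) =
     {{dihedral_elem (3 ^ d) i False, dihedral_elem (3 ^ d) (i + 3 ^ k) True} | i k.
        k \<le> d \<and> i \<in> digit_set d 1 \<and> i + 3 ^ k \<in> digit_set d 2}"
proof -
  define e where "e i k = {dihedral_elem (3 ^ d) i False, dihedral_elem (3 ^ d) (i + 3 ^ k) True}"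
    for i k
  have "edges (power3_graph d) = {e i k | i k. k \<le> d}"
    unfolding power3_graph_def e_def by (subst edges_cayley_dihedral) auto
  then have "edges (induced_subgraph (power3_graph d) (digit_vertices d)) =
      {e i k | i k. k \<le> d \<and> e i k \<subseteq> digit_vertices d}"
    by (auto simp: induced_subgraph_def)
  moreover have "e i k \<subseteq> digit_vertices d \<longleftrightarrow> i \<in> digit_set d 1 \<and> i + 3 ^ k \<in> digit_set d 2"
    for i k
    by (simp add: e_def elem_in_digit_vertices_iff)
  ultimately show ?thesis unfolding e_def by simp
qed

text \<open>Existence of the power \<open>3 ^ k\<close> from either side gives the covering, and its
  uniqueness gives disjointness.\<close>

lemma is_matching_digit_vertices:
  "is_matching (induced_subgraph (power3_graph d) (digit_vertices d))"
proof -
  let ?E = "dihedral_elem (3 ^ d)"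
  let ?H = "induced_subgraph (power3_graph d) (digit_vertices d)"
  have "e = e'" if e: "e \<in> edges ?H" "e' \<in> edges ?H" and x: "x \<in> e" "x \<in> e'" for e e' x
  proof -
    obtain i k where e1: "e = {?E i False, ?E (i + 3 ^ k) True}" "k \<le> d"
      "i \<in> digit_set d 1" "i + 3 ^ k \<in> digit_set d 2"
      using e(1) by (auto simp: edges_induced_digit_vertices)
    obtain j l where e2: "e' = {?E j False, ?E (j + 3 ^ l) True}" "l \<le> d"
      "j \<in> digit_set d 1" "j + 3 ^ l \<in> digit_set d 2"
      using e(2) by (auto simp: edges_induced_digit_vertices)
    \<comment> \<open>A common vertex is a rotation in both edges or a reflection in both.\<close>
    from x consider (1) "3 ^ d dvd j - i" | (2) "3 ^ d dvd (j + 3 ^ l) - (i + 3 ^ k)"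
      unfolding e1(1) e2(1) by (auto simp: dihedral_elem_eq_iff dvd_diff_commute)
    then show "e = e'"
    proof cases
      case 1
      \<comment> \<open>As \<open>i\<close> and \<open>j\<close> are congruent, both
        \<open>3 ^ k\<close> and \<open>3 ^ l\<close> carry \<open>i\<close> into the second digit
        set.\<close>
      then have "i + 3 ^ l \<in> digit_set d 2"
        using digit_set_cong[OF e2(4), of "i + 3 ^ l"] by simp
      then have "k = l" using digit_set_add_power_ex1[OF e1(3)] e1 e2 by blast
      moreover from this have "?E i False = ?E j False" "?E (i + 3 ^ k) True = ?E (j + 3 ^ l) True"
        using 1 by (simp_all add: dihedral_elem_eq_iff dvd_diff_commute)
      ultimately show ?thesis by (simp add: e1(1) e2(1))
    next
      case 2
      \<comment> \<open>With the reflection in common, both powers lead back from it into the first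
        digit set.\<close>
      then have "i + 3 ^ k - 3 ^ l \<in> digit_set d 1"
        using digit_set_cong[OF e2(3), of "i + 3 ^ k - 3 ^ l"] by (simp add: algebra_simps)
      moreover have "i + 3 ^ k - 3 ^ k \<in> digit_set d 1" using e1 by simp
      ultimately have "k = l" using digit_set_diff_power_ex1[OF e1(4)] e1(2) e2(2) by blast
      moreover from this have "?E i False = ?E j False" "?E (i + 3 ^ k) True = ?E (j + 3 ^ l) True"
        using 2 by (simp_all add: dihedral_elem_eq_iff dvd_diff_commute)
      ultimately show ?thesis by (simp add: e1(1) e2(1))
    qed
  qed
  then have "pairwise disjnt (edges ?H)" unfolding pairwise_def disjnt_iff by blast
  moreover have "\<Union> (edges ?H) = verts ?H"
  proof
    show "\<Union> (edges ?H) \<subseteq> verts ?H"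
      unfolding edges_induced_digit_vertices
      by (auto simp: induced_subgraph_def power3_graph_def cayley_graph_def
          elem_in_digit_vertices_iff dihedral_elem_closed)
    show "verts ?H \<subseteq> \<Union> (edges ?H)"
    proof
      fix x assume "x \<in> verts ?H"
      then have "x \<in> digit_vertices d" by (simp add: induced_subgraph_def)
      then consider i where "x = ?E i False" "i \<in> digit_set d 1"
        | i where "x = ?E i True" "i \<in> digit_set d 2"
        by (auto simp: digit_vertices_def)
      then show "x \<in> \<Union> (edges ?H)"
      proof cases
        case 1
        then obtain k where "k \<le> d" "i + 3 ^ k \<in> digit_set d 2"
          using digit_set_add_power_ex1 by blast
        then have "{?E i False, ?E (i + 3 ^ k) True} \<in> edges ?H"
          unfolding edges_induced_digit_vertices using 1 by blast
        then show ?thesis using 1 by blast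
      next
        case 2
        then obtain k where "k \<le> d" "i - 3 ^ k \<in> digit_set d 1"
          using digit_set_diff_power_ex1 by blast
        then have "{?E (i - 3 ^ k) False, ?E i True} \<in> edges ?H"
          unfolding edges_induced_digit_vertices
          by (intro CollectI exI[of _ "i - 3 ^ k"] exI[of _ k]) (use 2 in simp)
        then show ?thesis using 2 by blast
      qed
    qed
  qed
  ultimately show ?thesis by (simp add: is_matching_def)
qed

text \<open>Each residue class is represented by its remainder modulo \<open>3 ^ d\<close>;
  remainder 0 gives the inserted element.\<close>

lemma digit_class_eq:
  assumes "c \<in> {1, 2}"
  shows "(\<lambda>i. dihedral_elem (3 ^ d) i s) ` digit_set d (int c) =
     insert (dihedral_elem (3 ^ d) 0 s) {dihedral_elem (3 ^ d) (int i) s | i.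
       1 \<le> i \<and> i \<le> 3 ^ d - 1 \<and> rightmost_nonzero_digit3 i = c}"
    (is "?L = insert ?z ?R")
proof
  show "?L \<subseteq> insert ?z ?R"
  proof
    fix x assume "x \<in> ?L"
    then obtain i where x: "x = dihedral_elem (3 ^ d) i s" and i: "i \<in> digit_set d (int c)" by auto
    show "x \<in> insert ?z ?R"
    proof (cases "3 ^ d dvd i")
      case True
      then show ?thesis by (simp add: x dihedral_elem_eq_iff)
    next
      case False
      define m where "m = nat (i mod 3 ^ d)"
      have m: "int m = i mod 3 ^ d" by (simp add: m_def)
      have cong: "3 ^ d dvd i - int m" by (simp add: m mod_eq_dvd_iff[symmetric])
      have m0: "0 < m" using False m by (metis gr0I mod_0_imp_dvd of_nat_0)
      have "int m < 3 ^ d" by (simp add: m)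
      then have mn: "m < 3 ^ d" by (metis of_nat_less_iff of_nat_numeral of_nat_power)
      have "low_digit d (int c) (int m)"
        using digit_set_cong[OF i cong] False by (simp add: digit_set_def m dvd_mod_iff)
      then have "rightmost_nonzero_digit3 m = c" using low_digit_iff_rightmost[OF m0 mn assms] by simp
      moreover have "x = dihedral_elem (3 ^ d) (int m) s" using cong by (simp add: x dihedral_elem_eq_iff)
      ultimately show ?thesis
        by (intro insertI2 CollectI exI[of _ m]) (use m0 mn in simp)
    qed
  qed
  have "int m \<in> digit_set d (int c)"
    if "1 \<le> m" "m \<le> 3 ^ d - 1" "rightmost_nonzero_digit3 m = c" for m
  proof -
    have "m < 3 ^ d" using that(1,2) by linarith
    then show ?thesis using that low_digit_iff_rightmost[of m d c] assms by (simp add: digit_set_def)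
  qed
  then show "insert ?z ?R \<subseteq> ?L" by (auto simp: digit_set_def)
qed

lemma digit_vertices_eq:
  "digit_vertices d =
     {dihedral_elem (3 ^ d) (int i) False | i.
        1 \<le> i \<and> i \<le> 3 ^ d - 1 \<and> rightmost_nonzero_digit3 i = 1}
   \<union> {dihedral_elem (3 ^ d) (int i) True | i.
        1 \<le> i \<and> i \<le> 3 ^ d - 1 \<and> rightmost_nonzero_digit3 i = 2}
   \<union> {dihedral_elem (3 ^ d) 0 False, dihedral_elem (3 ^ d) 0 True}"
  using digit_class_eq[of 1 d False] digit_class_eq[of 2 d True]
  by (simp add: digit_vertices_def insert_commute)

lemma card_digit_vertices: "card (digit_vertices d) = 3 ^ d + 1"
proof -
  let ?E = "dihedral_elem (3 ^ d)"
  \<comment> \<open>Every positive \<open>i < 3 ^ d\<close> has last nonzero digit 1 or 2 and so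
    contributes exactly one vertex; a single injective map counts both families.\<close>
  define g where "g i = ?E (int i) (rightmost_nonzero_digit3 i = 2)" for i
  have small: "\<not> 3 ^ d dvd int i" if "i \<in> {1..3 ^ d - 1}" for i
  proof
    assume "3 ^ d dvd int i"
    then have "3 ^ d dvd i" using int_dvd_int_iff[of "3 ^ d" i] by simp
    moreover have "0 < i" using that by simp
    ultimately have "3 ^ d \<le> i" by (rule dvd_imp_le)
    then show False using that zero_less_power[of "3 :: nat" d]
      by (simp only: atLeastAtMost_iff) linarith
  qed
  have "digit_vertices d = g ` {1..3 ^ d - 1} \<union> {?E 0 False, ?E 0 True}"
    (is "_ = ?I \<union> ?Z")
  proof -
    let ?P = "\<lambda>c. {i \<in> {1..3 ^ d - 1}. rightmost_nonzero_digit3 i = c}"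
    have "rightmost_nonzero_digit3 i = 1 \<or> rightmost_nonzero_digit3 i = 2"
      if "i \<in> {1..3 ^ d - 1}" for i
      using rightmost_nonzero_digit3_range[of i] that by simp
    then have "{1..3 ^ d - 1} = ?P 1 \<union> ?P 2" by blast
    then have "?I = g ` (?P 1 \<union> ?P 2)" by (rule arg_cong)
    also have "\<dots> = g ` ?P 1 \<union> g ` ?P 2" by (rule image_Un)
    also have "g ` ?P 1 = (\<lambda>i. ?E (int i) False) ` ?P 1" by (rule image_cong) (auto simp: g_def)
    also have "g ` ?P 2 = (\<lambda>i. ?E (int i) True) ` ?P 2" by (rule image_cong) (auto simp: g_def)
    finally have "?I = (\<lambda>i. ?E (int i) False) ` ?P 1 \<union> (\<lambda>i. ?E (int i) True) ` ?P 2" .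
    then show ?thesis unfolding digit_vertices_eq by (simp add: image_Collect conj_assoc)
  qed
  moreover have "inj_on g {1..3 ^ d - 1}"
  proof (rule inj_onI)
    fix i j assume ij: "i \<in> {1..3 ^ d - 1}" "j \<in> {1..3 ^ d - 1}" "g i = g j"
    then have "int (3 ^ d) dvd int i - int j" by (simp add: g_def dihedral_elem_eq_iff)
    then have "i mod 3 ^ d = j mod 3 ^ d"
      by (metis mod_eq_dvd_iff of_nat_eq_iff of_nat_mod)
    moreover have "i < 3 ^ d" "j < 3 ^ d" using ij(1,2) zero_less_power[of "3 :: nat" d]
      by (simp_all only: atLeastAtMost_iff) linarith+
    ultimately show "i = j" by simp
  qed
  then have "card ?I = 3 ^ d - 1" by (simp add: card_image)
  moreover have "?I \<inter> ?Z = {}"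
    using small by (auto simp: g_def dihedral_elem_eq_iff)
  moreover have "card ?Z = 2" by (simp add: dihedral_elem_eq_iff)
  ultimately have "card (digit_vertices d) = 3 ^ d - 1 + 2"
    using card_Un_disjoint[of ?I ?Z] by (simp only: finite_atLeastAtMost finite_imageI
        finite.emptyI finite.insertI simp_thms)
  \<comment> \<open>This makes the truncated subtraction in \<open>3 ^ d - 1 + 2\<close>
    exact.\<close>
  moreover have "(1 :: nat) \<le> 3 ^ d" by simp
  ultimately show ?thesis by linarith
qed

text \<open>The group has \<open>2 * 3 ^ d\<close> elements, so pairing bounds the independence
  number by \<open>3 ^ d\<close>, one less than the number of digit vertices.\<close>

lemma sensitivity_power3_graph: "sensitivity (power3_graph d) = 1"
proof (rule sensitivity_eq_1)
  \<comment> \<open>\<open>?b\<close> equals \<open>b\<close>; it is written with exponent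
    \<open>3 ^ d\<close> to match the member \<open>k = d\<close> of the connection set.\<close>
  let ?D = "dihedral_group (3 ^ d)" and ?b = "dihedral_elem (3 ^ d) (3 ^ d) True"
  have "card (carrier ?D) = 2 * 3 ^ d" by (simp add: card_carrier_dihedral)
  then have card: "finite (carrier ?D)" "card (carrier ?D) = 2 * 3 ^ d"
    by (auto intro: card_ge_0_finite)
  then show "finite (verts (power3_graph d))" by (simp add: power3_graph_def cayley_graph_def)
  have "?b \<noteq> \<one>\<^bsub>?D\<^esub>" by (simp add: dihedral_elem_basic(1) dihedral_elem_eq_iff)
  then have "2 * independence_number (power3_graph d) \<le> card (carrier ?D)"
    unfolding power3_graph_def
    by (intro independence_number_cayley_le[where b = ?b] group_dihedral card(1) dihedral_elem_closed) auto
  then show "independence_number (power3_graph d) < card (digit_vertices d)"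
    by (simp add: card card_digit_vertices)
  show "digit_vertices d \<subseteq> verts (power3_graph d)"
    by (auto simp: digit_vertices_def power3_graph_def cayley_graph_def dihedral_elem_closed)
  show "is_matching (induced_subgraph (power3_graph d) (digit_vertices d))"
    by (rule is_matching_digit_vertices)
qed

theorem theorem2p1:
  fixes d n :: nat
    and D (structure)
    and a b :: "dihedral_gen word set"
    and C M :: "dihedral_gen word set set"
    and G :: "dihedral_gen word set graph"
  assumes "n = 3 ^ d"
    and "D = dihedral_group n"
    and "a = dihedral_a n"
    and "b = dihedral_b n"
    and "C = {a [^] (3 ^ i :: nat) \<otimes> b | i :: nat. i \<le> d}"
    and "G = cayley_graph D C"
    and "M = {a [^] i | i :: nat. 1 \<le> i \<and> i \<le> n - 1 \<and> rightmost_nonzero_digit3 i = 1}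
           \<union> {a [^] i \<otimes> b | i :: nat. 1 \<le> i \<and> i \<le> n - 1 \<and> rightmost_nonzero_digit3 i = 2}
           \<union> {\<one>, b}"
  shows "card M = n + 1
       \<and> is_matching (induced_subgraph G M)
       \<and> sensitivity G = 1"
proof -
  \<comment> \<open>Normal forms turn \<open>C\<close> and \<open>M\<close> into the connection set
    and vertex set treated above.\<close>
  have reflection: "a [^] (i :: nat) \<otimes> b = dihedral_elem (3 ^ d) (int i) True" for i
    by (simp add: assms(1-4) dihedral_elem_basic dihedral_elem_mult)
  have "C = (\<lambda>k. dihedral_elem (3 ^ d) k True) ` ((^) 3 ` {..d})"
    unfolding assms(5) reflection by auto
  then have "G = power3_graph d" by (simp add: assms(1,2,6) power3_graph_def)
  moreover have "M = digit_vertices d"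
    unfolding assms(7) reflection digit_vertices_eq
    by (simp add: assms(1-4) dihedral_elem_basic)
  ultimately show ?thesis
    using card_digit_vertices is_matching_digit_vertices sensitivity_power3_graph assms(1) by simp
qed

end
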